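(* Let $R$ be an Artinian commutative ring with identity. Then the comaximal ideal graph $\mathbb{CIG}(R)$ is a complemented graph (equivalently, a uniquely complemented graph).
   Context: For a commutative ring $R$ with identity, the comaximal ideal graph $\mathbb{CIG}(R)$ is the simple undirected graph whose vertices are the proper ideals of $R$ that are not contained in the Jacobson radical $J(R)$, two distinct vertices $I$ and $J$ being adjacent iff $I+J=R$. In a graph $G$, for distinct vertices $a,b$ write $a\bot b$ if $a$ and $b$ are adjacent and no vertex of $G$ is adjacent to both $a$ and $b$. $G$ is complemented if for each vertex $a$ there is a vertex $b$ with $a\bot b$. $G$ is uniquely complemented if it is complemented and whenever $a\bot b$ and $a\bot c$, then $b$ and $c$ are adjacent to exactly the same vertices. *)

theory Defs
  imports
    "HOL-Algebra.Ideal"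
    "Graph_Theory.Pair_Digraph"
begin

section \<open>Artinian commutative rings and the Jacobson radical\<close>

text \<open>Since the ring is commutative, the (two-sided) ideals of HOL-Algebra are the
  ideals meant in the descending chain condition.\<close>

locale artinian_cring = cring +
  assumes descending_chain_stabilizes:
    "\<lbrakk>\<And>n :: nat. ideal (I n) R; \<And>n. I (Suc n) \<subseteq> I n\<rbrakk> \<Longrightarrow> \<exists>N. \<forall>n\<ge>N. I n = I N"

text \<open>The intersection with the carrier only matters for the zero ring, which has no
  maximal ideal.\<close>

definition jacobson_radical :: "('a, 'm) ring_scheme \<Rightarrow> 'a set" where
  "jacobson_radical R = carrier R \<inter> \<Inter>{M. maximalideal M R}"

section \<open>Orthogonal vertices and complemented graphs\<close>

text \<open>A simple undirected graph, possibly infinite, is a pair digraph whose arc relation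
  is symmetric and loop-free (locale \<^locale>\<open>pair_bidirected_digraph\<close>); two vertices
  \<open>a\<close>, \<open>b\<close> are adjacent iff \<open>(a, b) \<in> parcs G\<close>.\<close>

definition orthogonal :: "'v pair_pre_digraph \<Rightarrow> 'v \<Rightarrow> 'v \<Rightarrow> bool" where
  "orthogonal G a b \<longleftrightarrow>
     a \<in> pverts G \<and> b \<in> pverts G \<and> a \<noteq> b \<and> (a, b) \<in> parcs G \<and>
     \<not> (\<exists>c \<in> pverts G. (c, a) \<in> parcs G \<and> (c, b) \<in> parcs G)"

definition complemented_graph :: "'v pair_pre_digraph \<Rightarrow> bool" where
  "complemented_graph G \<longleftrightarrow> (\<forall>a \<in> pverts G. \<exists>b \<in> pverts G. orthogonal G a b)"

definition uniquely_complemented_graph :: "'v pair_pre_digraph \<Rightarrow> bool" where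
  "uniquely_complemented_graph G \<longleftrightarrow>
     complemented_graph G \<and>
     (\<forall>a \<in> pverts G. \<forall>b \<in> pverts G. \<forall>c \<in> pverts G.
        orthogonal G a b \<and> orthogonal G a c \<longrightarrow>
        (\<forall>x \<in> pverts G. (b, x) \<in> parcs G \<longleftrightarrow> (c, x) \<in> parcs G))"

section \<open>The comaximal ideal graph\<close>

definition CIG_vertices :: "('a, 'm) ring_scheme \<Rightarrow> 'a set set" where
  "CIG_vertices R = {I. ideal I R \<and> I \<noteq> carrier R \<and> \<not> I \<subseteq> jacobson_radical R}"

definition CIG :: "('a, 'm) ring_scheme \<Rightarrow> 'a set pair_pre_digraph" where
  "CIG R = \<lparr> pverts = CIG_vertices R,
     parcs = {(I, J). I \<in> CIG_vertices R \<and> J \<in> CIG_vertices R \<and> I \<noteq> J \<and>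
                      I <+>\<^bsub>R\<^esub> J = carrier R} \<rparr>"

lemma (in cring) CIG_simple_graph: "pair_bidirected_digraph (CIG R)"
proof unfold_locales
  have comm: "I <+>\<^bsub>R\<^esub> J = J <+>\<^bsub>R\<^esub> I"
    if "I \<in> CIG_vertices R" "J \<in> CIG_vertices R" for I J
  proof -
    have "I \<subseteq> carrier R" "J \<subseteq> carrier R"
      using that by (auto simp: CIG_vertices_def dest: ideal.Icarr)
    then show ?thesis
      by (rule set_add_comm)
  qed
  then show "symmetric (with_proj (CIG R))"
    by (auto simp: symmetric_def sym_def CIG_def)
qed (auto simp: CIG_def)

end

(* By the descending chain condition, a vertex I has an ideal J that is minimal among
   the ideals comaximal with I. If c were comaximal with both I and J, then so would be
   the intersection of c and J with I, so J would lie in c by minimality, making c the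
   whole ring; hence J is a complement of I. Uniqueness is purely formal: if a has the
   complements b and c, and x is adjacent to b, then the ideal c + x is comaximal with
   both a and b, so it cannot be a vertex, which forces c + x = R. *)

theory Submission
  imports Defs "HOL-Algebra.Ring_Divisibility"
begin

context ring
begin

lemma comaximal_iff:
  assumes "ideal I R" "ideal J R"
  shows "I <+>\<^bsub>R\<^esub> J = carrier R \<longleftrightarrow> (\<exists>i\<in>I. \<exists>j\<in>J. \<one> = i \<oplus> j)"
proof -
  have "I <+>\<^bsub>R\<^esub> J = carrier R \<longleftrightarrow> \<one> \<in> I <+>\<^bsub>R\<^esub> J"
    using ideal.one_imp_carrier[OF add_ideals[OF assms]] by auto
  then show ?thesis
    by (simp add: set_add_def')
qed

lemma comaximal_mono:
  assumes "ideal I R" "ideal J R" "ideal I' R" "ideal J' R" "I \<subseteq> I'" "J \<subseteq> J'"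
    and "I <+>\<^bsub>R\<^esub> J = carrier R"
  shows "I' <+>\<^bsub>R\<^esub> J' = carrier R"
  using assms comaximal_iff by (meson subsetD)

lemma ideal_add_subset:
  assumes "ideal K R" "I \<subseteq> K" "J \<subseteq> K"
  shows "I <+>\<^bsub>R\<^esub> J \<subseteq> K"
proof -
  interpret K: ideal K R by fact
  show ?thesis
    using assms(2,3) by (auto simp: set_add_def')
qed

lemma ideal_add_upper:
  assumes "ideal I R" "ideal J R"
  shows "I \<subseteq> I <+>\<^bsub>R\<^esub> J" "J \<subseteq> I <+>\<^bsub>R\<^esub> J"
proof -
  interpret I: ideal I R by fact
  interpret J: ideal J R by fact
  show "I \<subseteq> I <+>\<^bsub>R\<^esub> J"
    unfolding set_add_def' using J.zero_closed by (force intro: r_zero[symmetric])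
  show "J \<subseteq> I <+>\<^bsub>R\<^esub> J"
    unfolding set_add_def' using I.zero_closed by (force intro: l_zero[symmetric])
qed

text \<open>Write \<open>\<one> = j \<oplus> i\<close> and \<open>\<one> = k \<oplus> i'\<close> and
  substitute the second into \<open>j \<otimes> \<one> \<oplus> i\<close>. The product
  \<open>j \<otimes> k\<close> lies in both \<open>J\<close> and \<open>K\<close>, and all other
  terms are absorbed by \<open>I\<close>.\<close>

lemma comaximal_inter:
  assumes "ideal I R" "ideal J R" "ideal K R"
    and "J <+>\<^bsub>R\<^esub> I = carrier R" "K <+>\<^bsub>R\<^esub> I = carrier R"
  shows "(J \<inter> K) <+>\<^bsub>R\<^esub> I = carrier R"
proof -
  interpret I: ideal I R by fact
  interpret J: ideal J R by fact
  interpret K: ideal K R by fact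
  obtain j i where 1: "j \<in> J" "i \<in> I" "\<one> = j \<oplus> i"
    using assms comaximal_iff by meson
  obtain k i' where 2: "k \<in> K" "i' \<in> I" "\<one> = k \<oplus> i'"
    using assms comaximal_iff by meson
  have car: "j \<in> carrier R" "i \<in> carrier R" "k \<in> carrier R" "i' \<in> carrier R"
    using 1 2 by auto
  have "\<one> = j \<otimes> \<one> \<oplus> i"
    unfolding r_one[OF car(1)] by (fact 1(3))
  also have "\<dots> = j \<otimes> (k \<oplus> i') \<oplus> i"
    by (simp only: 2(3))
  also have "\<dots> = j \<otimes> k \<oplus> (j \<otimes> i' \<oplus> i)"
    using car by (simp add: r_distr a_assoc)
  finally have "\<one> = j \<otimes> k \<oplus> (j \<otimes> i' \<oplus> i)" .
  moreover have "j \<otimes> k \<in> J \<inter> K" "j \<otimes> i' \<oplus> i \<in> I"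
    using 1 2 car by (auto simp: J.I_r_closed K.I_l_closed I.I_l_closed)
  ultimately show ?thesis
    using comaximal_iff[OF i_intersect[OF assms(2,3)] assms(1)] by blast
qed

lemma exists_maximalideal_superset:
  assumes "ideal I R" "I \<noteq> carrier R"
  shows "\<exists>M. maximalideal M R \<and> I \<subseteq> M"
proof -
  \<comment> \<open>Zorn's lemma is applied to the proper ideals above \<open>I\<close>. Properness
    is phrased as omitting \<open>\<one>\<close>, a condition that visibly passes to unions of
    chains.\<close>
  let ?A = "{J. ideal J R \<and> I \<subseteq> J \<and> \<one> \<notin> J}"
  have "\<one> \<notin> I"
    using assms ideal.one_imp_carrier by blast
  then have "?A \<noteq> {}"
    using assms(1) by auto
  moreover have "\<Union>C \<in> ?A" if "C \<noteq> {}" "subset.chain ?A C" for C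
  proof -
    have sub: "C \<subseteq> ?A"
      using that(2) by (simp add: subset.chain_def)
    then have "subset.chain {J. ideal J R} C"
      using that(2) unfolding subset.chain_def by blast
    then have "ideal (\<Union>C) R"
      using chain_Union_is_ideal[of C] that(1) by simp
    moreover have "I \<subseteq> \<Union>C" "\<one> \<notin> \<Union>C"
      using sub that(1) by blast+
    ultimately show ?thesis
      by simp
  qed
  ultimately have "\<exists>M\<in>?A. \<forall>J\<in>?A. M \<subseteq> J \<longrightarrow> J = M"
    by (rule subset_Zorn_nonempty)
  then obtain M where M: "ideal M R" "I \<subseteq> M" "\<one> \<notin> M"
    and max: "\<And>J. \<lbrakk>ideal J R; I \<subseteq> J; \<one> \<notin> J; M \<subseteq> J\<rbrakk> \<Longrightarrow> J = M"
    by auto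
  have "maximalideal M R"
  proof (rule maximalidealI)
    show "carrier R \<noteq> M"
      using M(3) by auto
    show "J = M \<or> J = carrier R" if "ideal J R" "M \<subseteq> J" for J
      using that M(2) max[of J] ideal.one_imp_carrier[OF that(1)] by auto
  qed (fact M(1))
  then show ?thesis
    using M(2) by auto
qed

text \<open>If \<open>I\<close> were proper, a maximal ideal above \<open>I\<close> would also
  contain \<open>J\<close>, hence all of \<open>I + J\<close>. Later this shows that the chosen
  complement is not inside the radical and so is a vertex.\<close>

lemma comaximal_jacobson_radical_imp:
  assumes "ideal I R" "ideal J R" "I <+>\<^bsub>R\<^esub> J = carrier R" "J \<subseteq> jacobson_radical R"
  shows "I = carrier R"
proof (rule ccontr)
  assume "I \<noteq> carrier R"
  then obtain M where M: "maximalideal M R" "I \<subseteq> M"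
    using exists_maximalideal_superset assms(1) by blast
  have "ideal M R"
    using M(1) by (rule maximalideal.axioms)
  moreover have "J \<subseteq> M"
    using assms(4) M(1) by (auto simp: jacobson_radical_def)
  ultimately have "carrier R \<subseteq> M"
    using ideal_add_subset[of M I J] M(2) assms(3) by simp
  then show False
    using maximalideal.I_notcarr[OF M(1)] ideal.Icarr[OF \<open>ideal M R\<close>] by blast
qed

text \<open>Some maximal ideal \<open>M\<close> fails to contain \<open>I\<close>, so
  \<open>M + I\<close> is strictly above \<open>M\<close> and must be the whole ring. This
  \<open>M\<close> later bounds the search for a complement of \<open>I\<close>.\<close>

lemma not_subset_jacobson_radical_imp:
  assumes "ideal I R" "\<not> I \<subseteq> jacobson_radical R"
  shows "\<exists>M. maximalideal M R \<and> M <+>\<^bsub>R\<^esub> I = carrier R"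
proof -
  obtain M where M: "maximalideal M R" "\<not> I \<subseteq> M"
    \<comment> \<open>Since \<open>I\<close> lies in the carrier, its failure to lie in
      \<open>jacobson_radical R\<close> comes from a maximal ideal and not from the intersection
      with the carrier.\<close>
    using assms ideal.Icarr[OF assms(1)] by (auto simp: jacobson_radical_def)
  then interpret M: maximalideal M R by simp
  have "ideal (M <+>\<^bsub>R\<^esub> I) R"
    by (rule add_ideals[OF M.is_ideal assms(1)])
  then have "M <+>\<^bsub>R\<^esub> I = M \<or> M <+>\<^bsub>R\<^esub> I = carrier R"
    using ideal_add_upper(1)[OF M.is_ideal assms(1)] ideal.Icarr
    by (intro M.I_maximal) auto
  then show ?thesis
    using M ideal_add_upper(2)[OF M.is_ideal assms(1)] by auto
qed

end

text \<open>Without a minimal member, dependent choice would produce a strictly decreasing sequence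
  in \<open>S\<close>, contradicting stabilization.\<close>

lemma (in artinian_cring) exists_minimal_ideal:
  assumes "S \<noteq> {}" "\<And>I. I \<in> S \<Longrightarrow> ideal I R"
  shows "\<exists>J\<in>S. \<forall>K\<in>S. K \<subseteq> J \<longrightarrow> K = J"
proof (rule ccontr)
  assume "\<not> ?thesis"
  then have step: "\<And>J. J \<in> S \<Longrightarrow> \<exists>K. K \<in> S \<and> K \<subset> J"
    by blast
  have "\<exists>f :: nat \<Rightarrow> 'a set. \<forall>n. f n \<in> S \<and> f (Suc n) \<subset> f n"
    by (rule dependent_nat_choice) (use assms(1) step in auto)
  then obtain f :: "nat \<Rightarrow> 'a set" where "\<forall>n. f n \<in> S \<and> f (Suc n) \<subset> f n" ..
  then have f: "f n \<in> S" "f (Suc n) \<subset> f n" for n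
    by simp_all
  have "\<exists>N. \<forall>n\<ge>N. f n = f N"
    using f(1) by (intro descending_chain_stabilizes assms(2) psubset_imp_subset f(2))
  then obtain N where N: "\<forall>n\<ge>N. f n = f N" ..
  have "f (Suc N) = f N"
    by (rule N[rule_format]) simp
  with f(2)[of N] show False
    by simp
qed

context cring
begin

text \<open>The condition \<open>I \<noteq> J\<close> is automatic: for a vertex \<open>I\<close>,
  the sum \<open>I + I\<close> stays inside \<open>I\<close>, which is proper.\<close>

lemma CIG_arc_iff:
  "(I, J) \<in> parcs (CIG R) \<longleftrightarrow>
     I \<in> CIG_vertices R \<and> J \<in> CIG_vertices R \<and> I <+>\<^bsub>R\<^esub> J = carrier R"
proof -
  have "I <+>\<^bsub>R\<^esub> I \<noteq> carrier R" if "I \<in> CIG_vertices R" for I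
    using that ideal_add_subset[of I I I] ideal.Icarr[of I R]
    by (auto simp: CIG_vertices_def)
  then show ?thesis
    by (auto simp: CIG_def)
qed

lemma CIG_arc_sym: "(I, J) \<in> parcs (CIG R) \<Longrightarrow> (J, I) \<in> parcs (CIG R)"
  using set_add_comm[of I J] ideal.Icarr
  by (fastforce simp: CIG_arc_iff CIG_vertices_def)

text \<open>One implication suffices for uniqueness of complements, since exchanging
  \<open>b\<close> and \<open>c\<close> yields the converse.\<close>

lemma orthogonal_CIG_arc_transfer:
  assumes ab: "orthogonal (CIG R) a b" and ac: "orthogonal (CIG R) a c"
    and bx: "(b, x) \<in> parcs (CIG R)"
  shows "(c, x) \<in> parcs (CIG R)"
proof (rule ccontr)
  let ?y = "c <+>\<^bsub>R\<^esub> x"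
  assume "(c, x) \<notin> parcs (CIG R)"
  have arcs: "(c, a) \<in> parcs (CIG R)" "(x, b) \<in> parcs (CIG R)"
    using ac bx CIG_arc_sym by (auto simp: orthogonal_def)
  then have ideals: "ideal a R" "ideal b R" "ideal c R" "ideal x R"
    by (auto simp: CIG_arc_iff CIG_vertices_def)
  have y: "ideal ?y R" "c \<subseteq> ?y" "x \<subseteq> ?y"
    using ideals add_ideals ideal_add_upper by auto
  have "?y \<noteq> carrier R"
    using \<open>(c, x) \<notin> _\<close> arcs by (auto simp: CIG_arc_iff)
  moreover have "\<not> c \<subseteq> jacobson_radical R"
    using arcs by (auto simp: CIG_arc_iff CIG_vertices_def)
  ultimately have "?y \<in> CIG_vertices R"
    using y by (auto simp: CIG_vertices_def)
  \<comment> \<open>Comaximality with \<open>a\<close> is inherited from \<open>c\<close>, and with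
    \<open>b\<close> from \<open>x\<close>, because enlarging an ideal preserves
    comaximality.\<close>
  moreover have "?y <+>\<^bsub>R\<^esub> a = carrier R" "?y <+>\<^bsub>R\<^esub> b = carrier R"
    using comaximal_mono[of c a ?y a] comaximal_mono[of x b ?y b] arcs ideals y
    by (auto simp: CIG_arc_iff)
  ultimately have "(?y, a) \<in> parcs (CIG R)" "(?y, b) \<in> parcs (CIG R)"
    using arcs by (auto simp: CIG_arc_iff)
  moreover have "?y \<in> pverts (CIG R)"
    using \<open>?y \<in> CIG_vertices R\<close> by (simp add: CIG_def)
  ultimately show False
    using ab by (auto simp: orthogonal_def)
qed

end

lemma (in artinian_cring) complemented_CIG: "complemented_graph (CIG R)"
  unfolding complemented_graph_def
proof
  fix I assume "I \<in> pverts (CIG R)"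
  then have V: "I \<in> CIG_vertices R"
    by (simp add: CIG_def)
  then have I: "ideal I R" "I \<noteq> carrier R" "\<not> I \<subseteq> jacobson_radical R"
    by (auto simp: CIG_vertices_def)
  obtain M where M: "maximalideal M R" "M <+>\<^bsub>R\<^esub> I = carrier R"
    using not_subset_jacobson_radical_imp I by blast
  (* The bound by M only serves to keep the minimal ideal proper. *)
  let ?S = "{J. ideal J R \<and> J <+>\<^bsub>R\<^esub> I = carrier R \<and> J \<subseteq> M}"
  have "ideal M R"
    using M(1) by (rule maximalideal.axioms)
  then have "M \<in> ?S"
    using M(2) by simp
  then have "\<exists>J\<in>?S. \<forall>K\<in>?S. K \<subseteq> J \<longrightarrow> K = J"
    by (intro exists_minimal_ideal) auto
  then obtain J where "J \<in> ?S" and min: "\<And>K. K \<in> ?S \<Longrightarrow> K \<subseteq> J \<Longrightarrow> K = J"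
    by (elim bexE) simp
  then have J: "ideal J R" "J <+>\<^bsub>R\<^esub> I = carrier R" "J \<subseteq> M"
    by auto
  have "I <+>\<^bsub>R\<^esub> J = carrier R"
    using J(1,2) I(1) set_add_comm[of I J] ideal.Icarr by (metis subsetI)
  moreover have "J \<noteq> carrier R"
    using J(3) maximalideal.I_notcarr[OF M(1)] ideal.Icarr[OF \<open>ideal M R\<close>] by blast
  \<comment> \<open>If \<open>J\<close> were inside the radical, comaximality would force
    \<open>I\<close> to be the whole ring.\<close>
  ultimately have JV: "J \<in> CIG_vertices R"
    using comaximal_jacobson_radical_imp[of I J] I J(1) by (auto simp: CIG_vertices_def)
  have "(I, J) \<in> parcs (CIG R)"
    using \<open>I <+>\<^bsub>R\<^esub> J = carrier R\<close> V JV by (simp add: CIG_arc_iff)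
  moreover have "False" if "(c, I) \<in> parcs (CIG R)" "(c, J) \<in> parcs (CIG R)" for c
  proof -
    have c: "ideal c R" "c \<noteq> carrier R" "c <+>\<^bsub>R\<^esub> I = carrier R" "c <+>\<^bsub>R\<^esub> J = carrier R"
      using that by (auto simp: CIG_arc_iff CIG_vertices_def)
    have "c \<inter> J \<in> ?S"
      using comaximal_inter[of I c J] i_intersect[of c J] c J I(1) by auto
    then have "J \<subseteq> c"
      using min[of "c \<inter> J"] by blast
    \<comment> \<open>Once \<open>J\<close> lies in \<open>c\<close>, the sum \<open>c + J\<close>,
      which is the whole ring, collapses into \<open>c\<close>.\<close>
    then have "carrier R \<subseteq> c"
      using ideal_add_subset[of c c J] c by simp
    then show False
      using c(2) ideal.Icarr[OF c(1)] by blast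
  qed
  moreover have "I \<noteq> J"
    using \<open>(I, J) \<in> _\<close> by (auto simp: CIG_def)
  moreover have "I \<in> pverts (CIG R)" "J \<in> pverts (CIG R)"
    using V JV by (simp_all add: CIG_def)
  ultimately have "orthogonal (CIG R) I J"
    unfolding orthogonal_def by auto
  then show "\<exists>b\<in>pverts (CIG R). orthogonal (CIG R) I b"
    using \<open>J \<in> pverts (CIG R)\<close> by (rule bexI)
qed

theorem theorem3p3:
  fixes R :: "('a, 'm) ring_scheme"
  assumes "artinian_cring R"
  shows "complemented_graph (CIG R) \<and> uniquely_complemented_graph (CIG R)"
proof -
  interpret artinian_cring R by fact
  show ?thesis
    unfolding uniquely_complemented_graph_def
    \<comment> \<open>The goals left after \<open>intro\<close> are the two directions of the
      equivalence; the second uses the transfer lemma with \<open>b\<close> and \<open>c\<close>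
      exchanged.\<close>
    by (intro conjI complemented_CIG ballI impI iffI) (elim conjE, erule (2) orthogonal_CIG_arc_transfer)+
qed

end
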